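(* Let $H$ be a real or complex Hilbert space, let $M_1, M_2$ be closed subspaces of $H$, let $P_1,P_2$ be the orthogonal projections onto $M_1,M_2$ respectively, and let $P_M$ be the orthogonal projection onto $M=M_1\cap M_2$. Then for any $x \in H$, $$\|(P_2P_1)^n x -P_Mx\| \to 0 \quad\text{as } n \to \infty.$$ *)

theory Defs
  imports "HOL-Analysis.Analysis"
begin

text \<open>
  Real Hilbert spaces are the types of sort \<open>{real_inner, complete_space}\<close>. The libraries have no
  complex counterpart; it is defined here. A complex Hilbert space also carries its underlying real
  normed space structure, so that the usual limits, \<open>closed\<close> and \<open>complete_space\<close> apply. This costs
  no generality: \<open>scaleR\<close> is determined by \<open>scaleR_scaleC\<close> and the norm by \<open>norm_eq_sqrt_cinner\<close>.
\<close>

class complex_vector = real_vector +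
  fixes scaleC :: "complex \<Rightarrow> 'a \<Rightarrow> 'a"  (infixr "*\<^sub>C" 75)
  assumes scaleR_scaleC: "r *\<^sub>R x = complex_of_real r *\<^sub>C x"
    and scaleC_add_right: "a *\<^sub>C (x + y) = a *\<^sub>C x + a *\<^sub>C y"
    and scaleC_add_left: "(a + b) *\<^sub>C x = a *\<^sub>C x + b *\<^sub>C x"
    and scaleC_scaleC: "a *\<^sub>C b *\<^sub>C x = (a * b) *\<^sub>C x"
    and scaleC_one: "1 *\<^sub>C x = x"

global_interpretation complex_vector:
  vector_space "scaleC :: complex \<Rightarrow> 'a \<Rightarrow> 'a::complex_vector"
  defines csubspace = complex_vector.subspace
  by unfold_locales (simp_all add: scaleC_add_right scaleC_add_left scaleC_scaleC scaleC_one)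

class complex_inner = complex_vector + real_normed_vector +
  fixes cinner :: "'a \<Rightarrow> 'a \<Rightarrow> complex"
  assumes cinner_commute: "cinner x y = cnj (cinner y x)"
    and cinner_add_left: "cinner (x + y) z = cinner x z + cinner y z"
    and cinner_scaleC_left: "cinner (a *\<^sub>C x) y = a * cinner x y"
    \<comment> \<open>\<open>cinner x x\<close> is real by \<open>cinner_commute\<close>\<close>
    and cinner_ge_zero: "0 \<le> Re (cinner x x)"
    and cinner_eq_zero_iff: "cinner x x = 0 \<longleftrightarrow> x = 0"
    and norm_eq_sqrt_cinner: "norm x = sqrt (Re (cinner x x))"

class complex_hilbert_space = complex_inner + complete_space

instantiation complex :: complex_hilbert_space
begin

definition scaleC_complex :: "complex \<Rightarrow> complex \<Rightarrow> complex" where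
  "scaleC_complex a x = a * x"

definition cinner_complex :: "complex \<Rightarrow> complex \<Rightarrow> complex" where
  "cinner_complex x y = x * cnj y"

instance
  by standard
    (auto simp: scaleC_complex_def cinner_complex_def scaleR_conv_of_real algebra_simps
      cmod_def power2_eq_square)

end

text \<open>
  The orthogonal projection of \<open>x\<close> onto \<open>M\<close> is the point of \<open>M\<close> whose difference from \<open>x\<close> is
  orthogonal to \<open>M\<close>. For a closed subspace of a Hilbert space it exists and is unique; otherwise
  the description operator may be unspecified.
\<close>

definition orth_proj :: "'a::real_inner set \<Rightarrow> 'a \<Rightarrow> 'a" where
  "orth_proj M x = (THE y. y \<in> M \<and> (\<forall>z\<in>M. orthogonal (x - y) z))"

definition corth_proj :: "'a::complex_inner set \<Rightarrow> 'a \<Rightarrow> 'a" where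
  "corth_proj M x = (THE y. y \<in> M \<and> (\<forall>z\<in>M. cinner (x - y) z = 0))"

end

theory Submission
  imports Defs
begin

text \<open>
  With \<open>u\<^sub>n = P\<^sub>1 (P\<^sub>2 P\<^sub>1)\<^sup>n x\<close> and the self-adjoint operator \<open>P\<^sub>1 P\<^sub>2\<close> on \<open>M\<^sub>1\<close>, the inner product
  \<open>\<langle>u\<^sub>m, u\<^sub>n\<rangle> = a\<^bsub>m+n\<^esub>\<close> depends only on \<open>m + n\<close>. The even terms of \<open>a\<close> are the numbers \<open>\<parallel>u\<^sub>n\<parallel>\<^sup>2\<close>, the odd
  ones are \<open>\<parallel>P\<^sub>2 u\<^sub>n\<parallel>\<^sup>2\<close>, so \<open>a\<close> decreases to some \<open>L \<ge> 0\<close> and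
  \<open>\<parallel>u\<^sub>m - u\<^sub>n\<parallel>\<^sup>2 = a\<^bsub>2m\<^esub> - 2 a\<^bsub>m+n\<^esub> + a\<^bsub>2n\<^esub> \<le> (a\<^bsub>2m\<^esub> - L) + (a\<^bsub>2n\<^esub> - L)\<close>: the sequence \<open>u\<close> is Cauchy.
  Its limit is fixed by \<open>P\<^sub>1 P\<^sub>2\<close>, hence lies in \<open>M\<^sub>1 \<inter> M\<^sub>2\<close>, and has the same inner products with
  elements of \<open>M\<^sub>1 \<inter> M\<^sub>2\<close> as \<open>x\<close>. The complex case reduces to the real one by passing to the real
  part of the inner product.
\<close>

text \<open>Serves both Cauchy arguments below, where the parallelogram law or a direct expansion
  leaves one error term per index.\<close>

lemma Cauchy_if_norm_diff_sq_le:
  fixes s :: "nat \<Rightarrow> 'a::real_normed_vector"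
  assumes le: "\<And>m n. (norm (s m - s n))\<^sup>2 \<le> e m + e n" and e: "e \<longlonglongrightarrow> 0"
  shows "Cauchy s"
proof (rule metric_CauchyI)
  fix r :: real
  assume "0 < r"
  then have "\<forall>\<^sub>F n in sequentially. e n < r\<^sup>2 / 2"
    using e by (intro order_tendstoD) auto
  then obtain N where N: "\<And>n. n \<ge> N \<Longrightarrow> e n < r\<^sup>2 / 2"
    by (auto simp: eventually_sequentially)
  have "dist (s m) (s n) < r" if "m \<ge> N" "n \<ge> N" for m n
  proof -
    have "(norm (s m - s n))\<^sup>2 < r\<^sup>2"
      using le[of m n] N[OF that(1)] N[OF that(2)] by linarith
    then show ?thesis
      using \<open>0 < r\<close> by (simp add: dist_norm power_less_imp_less_base)
  qed
  then show "\<exists>N. \<forall>m\<ge>N. \<forall>n\<ge>N. dist (s m) (s n) < r" by blast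
qed

text \<open>
  A locale rather than the class \<open>real_inner\<close>, so that the real part of a complex inner product
  is an instance too.
\<close>

locale real_hilbert =
  fixes ip :: "'a::{real_normed_vector, complete_space} \<Rightarrow> 'a \<Rightarrow> real"
  assumes ip_commute: "ip x y = ip y x"
    and ip_add_left: "ip (x + y) z = ip x z + ip y z"
    and ip_scaleR_left: "ip (r *\<^sub>R x) y = r * ip x y"
    and norm_sq: "(norm x)\<^sup>2 = ip x x"
begin

lemma ip_minus_left: "ip (- x) y = - ip x y"
  using ip_scaleR_left[of "-1" x y] by simp

lemma ip_diff_left: "ip (x - y) z = ip x z - ip y z"
  using ip_add_left[of x "- y" z] by (simp add: ip_minus_left)

lemma ip_add_right: "ip z (x + y) = ip z x + ip z y"
  by (metis ip_commute ip_add_left)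

lemma ip_diff_right: "ip z (x - y) = ip z x - ip z y"
  by (metis ip_commute ip_diff_left)

lemma ip_scaleR_right: "ip x (r *\<^sub>R y) = r * ip x y"
  by (metis ip_commute ip_scaleR_left)

lemmas ip_simps = ip_add_left ip_add_right ip_diff_left ip_diff_right
  ip_scaleR_left ip_scaleR_right

lemma ip_zero_left: "ip 0 y = 0"
  using ip_scaleR_left[of 0 0 y] by simp

lemma ip_self_eq_0: "ip x x = 0 \<Longrightarrow> x = 0"
  using norm_sq[of x] by simp

text \<open>Reduces continuity of \<open>ip\<close>, which the locale does not assume, to continuity
  of the norm.\<close>

lemma ip_polarization: "ip x y = ((norm (x + y))\<^sup>2 - (norm x)\<^sup>2 - (norm y)\<^sup>2) / 2"
  by (simp add: norm_sq ip_simps ip_commute[of y x])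

lemma tendsto_ip:
  assumes "(f \<longlongrightarrow> a) F" "(g \<longlongrightarrow> b) F"
  shows "((\<lambda>n. ip (f n) (g n)) \<longlongrightarrow> ip a b) F"
  unfolding ip_polarization by (intro tendsto_intros assms) simp

section \<open>Existence and uniqueness of orthogonal projections\<close>

lemma parallelogram:
  fixes x y :: 'a
  shows "(norm (x + y))\<^sup>2 + (norm (x - y))\<^sup>2 = 2 * (norm x)\<^sup>2 + 2 * (norm y)\<^sup>2"
  by (simp add: norm_sq ip_simps)

text \<open>A minimizing sequence is Cauchy: by convexity the midpoint of two of its terms lies in
  \<open>M\<close>, hence at distance at least \<open>d\<close> from \<open>x\<close>, and the
  parallelogram law then bounds the distance between the terms.\<close>

lemma nearest_point_exists:
  fixes M :: "'a set"
  assumes "closed M" "convex M" "M \<noteq> {}"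
  obtains y where "y \<in> M" "\<And>z. z \<in> M \<Longrightarrow> norm (x - y) \<le> norm (x - z)"
proof -
  define d where "d = infdist x M"
  have d: "d \<le> norm (x - z)" if "z \<in> M" for z
    unfolding d_def using infdist_le[OF that, of x] by (simp add: dist_norm)
  have d0: "0 \<le> d"
    by (simp add: d_def infdist_nonneg)
  have "\<exists>y\<in>M. norm (x - y) < d + 1 / Suc n" for n :: nat
  proof -
    have "(INF a\<in>M. dist x a) < d + 1 / Suc n"
      using \<open>M \<noteq> {}\<close> by (simp add: d_def infdist_def)
    then show ?thesis
      using \<open>M \<noteq> {}\<close> by (subst (asm) cINF_less_iff) (auto simp: dist_norm intro!: bdd_belowI2[where m = 0])
  qed
  then obtain s where sM: "\<And>n. s n \<in> M" and s: "\<And>n. norm (x - s n) < d + 1 / Suc n"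
    by metis
  have lim: "(\<lambda>n. norm (x - s n)) \<longlonglongrightarrow> d"
  proof (rule tendsto_sandwich[where f = "\<lambda>_. d"])
    show "(\<lambda>n. d + 1 / Suc n) \<longlonglongrightarrow> d"
      using tendsto_add[OF tendsto_const LIMSEQ_inverse_real_of_nat, of d]
      by (simp add: inverse_eq_divide)
    show "\<forall>\<^sub>F n in sequentially. norm (x - s n) \<le> d + 1 / Suc n"
      using s by (intro always_eventually allI less_imp_le)
  qed (simp_all add: d sM)
  have "Cauchy s"
  proof (rule Cauchy_if_norm_diff_sq_le)
    let ?e = "\<lambda>n. 2 * ((norm (x - s n))\<^sup>2 - d\<^sup>2)"
    show "(norm (s m - s n))\<^sup>2 \<le> ?e m + ?e n" for m n
    proof -
      have "(1/2) *\<^sub>R s m + (1/2) *\<^sub>R s n \<in> M"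
        using sM by (intro convexD[OF \<open>convex M\<close>]) auto
      \<comment> \<open>Doubling turns the vector from the midpoint to \<open>x\<close> into the sum
        that occurs in the parallelogram law.\<close>
      from d[OF this] have "2 * d \<le> 2 * norm (x - ((1/2) *\<^sub>R s m + (1/2) *\<^sub>R s n))"
        by simp
      also have "\<dots> = norm (2 *\<^sub>R (x - ((1/2) *\<^sub>R s m + (1/2) *\<^sub>R s n)))"
        by simp
      also have "2 *\<^sub>R (x - ((1/2) *\<^sub>R s m + (1/2) *\<^sub>R s n)) = (x - s n) + (x - s m)"
        by (simp add: algebra_simps scaleR_2)
      finally have "(2 * d)\<^sup>2 \<le> (norm ((x - s n) + (x - s m)))\<^sup>2"
        using d0 by (intro power_mono) auto
      then show ?thesis
        using parallelogram[of "x - s n" "x - s m"] by (simp add: power_mult_distrib)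
    qed
    have "?e \<longlonglongrightarrow> 2 * (d\<^sup>2 - d\<^sup>2)"
      by (intro tendsto_intros lim)
    then show "?e \<longlonglongrightarrow> 0" by simp
  qed
  then obtain y where y: "s \<longlonglongrightarrow> y"
    using Cauchy_convergent convergent_def by blast
  have "norm (x - y) = d"
    using LIMSEQ_unique[OF tendsto_norm[OF tendsto_diff[OF tendsto_const y]] lim] .
  moreover have "y \<in> M"
    using closed_sequentially[OF \<open>closed M\<close> sM y] .
  ultimately show thesis
    using d by (intro that) auto
qed

text \<open>Has the shape of \<open>orth_proj\<close> and \<open>corth_proj\<close>, so that each of
  them is identified with it by comparing the described conditions.\<close>

definition proj :: "'a set \<Rightarrow> 'a \<Rightarrow> 'a" where
  "proj M x = (THE y. y \<in> M \<and> (\<forall>z\<in>M. ip (x - y) z = 0))"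

text \<open>The nearest point is the witness: if \<open>x - y\<close> had a component along
  \<open>z\<close>, moving from \<open>y\<close> along \<open>z\<close> inside \<open>M\<close>
  would come closer to \<open>x\<close>.\<close>

lemma orthogonal_point_exists:
  assumes "closed M" "subspace M"
  shows "\<exists>y\<in>M. \<forall>z\<in>M. ip (x - y) z = 0"
proof -
  obtain y where y: "y \<in> M" "\<And>z. z \<in> M \<Longrightarrow> norm (x - y) \<le> norm (x - z)"
    using nearest_point_exists[OF assms(1) subspace_imp_convex[OF assms(2)]] subspace_0[OF assms(2)]
    by blast
  have "ip (x - y) z = 0" if "z \<in> M" for z
  proof (cases "z = 0")
    case True
    then show ?thesis by (metis ip_commute ip_zero_left)
  next
    case False
    define c where "c = ip (x - y) z"
    \<comment> \<open>The minimizer of the squared distance from \<open>x\<close> to the line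
      through \<open>y\<close> in direction \<open>z\<close>; it lowers the value at
      \<open>y\<close> by \<open>c * c / ip z z\<close>.\<close>
    define t where "t = c / ip z z"
    have pos: "0 < ip z z"
      using False by (simp flip: norm_sq)
    have "y + t *\<^sub>R z \<in> M"
      using assms(2) y(1) that by (simp add: subspace_add subspace_scale)
    then have "(norm (x - y))\<^sup>2 \<le> (norm (x - (y + t *\<^sub>R z)))\<^sup>2"
      by (intro power_mono y) auto
    also have "x - (y + t *\<^sub>R z) = (x - y) - t *\<^sub>R z"
      by simp
    also have "(norm ((x - y) - t *\<^sub>R z))\<^sup>2 = (norm (x - y))\<^sup>2 - 2 * t * c + t * (t * ip z z)"
      unfolding norm_sq c_def ip_diff_right[of _ "x - y"] ip_diff_left[of "x - y" "t *\<^sub>R z"]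
        ip_scaleR_left ip_scaleR_right
      using ip_commute[of z "x - y"] by (simp add: algebra_simps)
    also have "t * ip z z = c"
      using pos by (simp add: t_def)
    finally have "c * c / ip z z \<le> 0"
      by (simp add: t_def)
    then have "c * c \<le> 0"
      using pos by (simp add: divide_le_0_iff)
    then show ?thesis
      by (auto simp: c_def mult_le_0_iff)
  qed
  with y(1) show ?thesis by blast
qed

lemma orthogonal_point_unique:
  assumes "subspace M" "y \<in> M" "y' \<in> M"
    and "\<forall>z\<in>M. ip (x - y) z = 0" "\<forall>z\<in>M. ip (x - y') z = 0"
  shows "y = y'"
proof -
  have "y - y' \<in> M"
    using assms by (simp add: subspace_diff)
  then have "ip (x - y') (y - y') - ip (x - y) (y - y') = 0"
    using assms by simp
  then have "ip (y - y') (y - y') = 0"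
    unfolding ip_diff_left by simp
  then show ?thesis
    using ip_self_eq_0 by fastforce
qed

lemma proj_eqI:
  assumes "subspace M" "y \<in> M" "\<And>z. z \<in> M \<Longrightarrow> ip (x - y) z = 0"
  shows "proj M x = y"
  unfolding proj_def using assms orthogonal_point_unique by (intro the_equality) blast+

section \<open>Properties of the projection onto a closed subspace\<close>

context
  fixes M :: "'a set"
  assumes M: "subspace M" "closed M"
begin

lemma
  shows proj_mem: "proj M x \<in> M"
    and proj_orthogonal: "z \<in> M \<Longrightarrow> ip (x - proj M x) z = 0"
  using orthogonal_point_exists[OF M(2) M(1), of x] proj_eqI[OF M(1)] by auto

lemma proj_ident: "x \<in> M \<Longrightarrow> proj M x = x"
  using M by (intro proj_eqI) (auto simp: ip_zero_left)

lemma ip_proj_left: "z \<in> M \<Longrightarrow> ip (proj M x) z = ip x z"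
  using proj_orthogonal[of z x] by (simp add: ip_diff_left)

lemma ip_proj_self: "ip (proj M x) x = (norm (proj M x))\<^sup>2"
  using ip_proj_left[OF proj_mem, of x x] by (simp add: norm_sq ip_commute)

lemma proj_selfadjoint: "ip (proj M x) y = ip x (proj M y)"
  by (metis ip_commute ip_proj_left proj_mem)

lemma proj_pythagoras: "(norm x)\<^sup>2 = (norm (proj M x))\<^sup>2 + (norm (x - proj M x))\<^sup>2"
  using ip_proj_self[of x]
  by (simp add: norm_sq ip_diff_left ip_diff_right ip_commute[of x "proj M x"])

lemma norm_proj_le: "norm (proj M x) \<le> norm x"
proof (rule power2_le_imp_le)
  show "(norm (proj M x))\<^sup>2 \<le> (norm x)\<^sup>2"
    using proj_pythagoras[of x] zero_le_power2[of "norm (x - proj M x)"] by linarith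
qed simp

lemma proj_eq_self_if_norm: "norm (proj M x) = norm x \<Longrightarrow> proj M x = x"
  using proj_pythagoras[of x] by simp

lemma proj_diff: "proj M (x - y) = proj M x - proj M y"
proof (rule proj_eqI[OF M(1)])
  show "proj M x - proj M y \<in> M"
    using M(1) by (simp add: subspace_diff proj_mem)
  show "ip (x - y - (proj M x - proj M y)) z = 0" if "z \<in> M" for z
    using that by (simp add: ip_diff_left ip_proj_left)
qed

text \<open>By additivity and \<open>norm_proj_le\<close>, the projection is 1-Lipschitz.\<close>

lemma tendsto_proj:
  assumes "(f \<longlongrightarrow> a) F"
  shows "((\<lambda>n. proj M (f n)) \<longlongrightarrow> proj M a) F"
proof (rule Lim_transform_bound[where f = "\<lambda>n. proj M (f n) - proj M a", THEN LIM_zero_cancel])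
  show "\<forall>\<^sub>F n in F. norm (proj M (f n) - proj M a) \<le> norm (f n - a)"
    using norm_proj_le by (simp flip: proj_diff)
  show "((\<lambda>n. f n - a) \<longlongrightarrow> 0) F"
    using assms by (rule LIM_zero)
qed

end

section \<open>Convergence of alternating projections\<close>

theorem alternating_projections:
  assumes "subspace M1" "closed M1" "subspace M2" "closed M2"
  shows "(\<lambda>n. ((proj M2 \<circ> proj M1) ^^ n) x) \<longlonglongrightarrow> proj (M1 \<inter> M2) x"
proof -
  note M1 = assms(1,2) and M2 = assms(3,4)
  define T where "T n = ((proj M2 \<circ> proj M1) ^^ n) x" for n
  define u where "u n = proj M1 (T n)" for n
  have T_Suc: "T (Suc n) = proj M2 (u n)" for n
    by (simp add: T_def u_def)
  have u_Suc: "u (Suc n) = proj M1 (proj M2 (u n))" for n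
    by (simp add: u_def T_Suc)
  have u_mem: "u n \<in> M1" for n
    by (simp add: u_def proj_mem[OF M1])
  have shift: "ip (u (Suc m)) (u n) = ip (proj M2 (u m)) (u n)" for m n
    by (simp add: u_Suc ip_proj_left[OF M1 u_mem])
  \<comment> \<open>By \<open>shift\<close> only \<open>proj M2\<close> remains, and it is
    self-adjoint. Moving indices across one at a time then gives \<open>ip_u\<close>, with
    \<open>m\<close> growing as \<open>n\<close> shrinks.\<close>
  have swap: "ip (u (Suc m)) (u n) = ip (u m) (u (Suc n))" for m n
    by (metis shift proj_selfadjoint[OF M2] ip_commute)
  define a where "a k = ip (u k) (u 0)" for k
  have ip_u: "ip (u m) (u n) = a (m + n)" for m n
    by (induction n arbitrary: m) (simp_all add: a_def flip: swap)
  have even: "(norm (u n))\<^sup>2 = a (2 * n)" for n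
    by (simp add: norm_sq ip_u mult_2)
  have odd: "(norm (proj M2 (u n)))\<^sup>2 = a (Suc (2 * n))" for n
    using ip_u[of "Suc n" n] by (simp add: shift ip_proj_self[OF M2] mult_2)
  \<comment> \<open>Each step of \<open>a\<close> applies one more projection:
    \<open>proj M2\<close> from even to odd indices, \<open>proj M1\<close> from odd to even
    ones.\<close>
  have "a (Suc k) \<le> a k" for k
  proof (cases "even k")
    case True
    then show ?thesis
      by (auto elim!: evenE simp flip: even odd intro!: power_mono norm_proj_le[OF M2])
  next
    case False
    then obtain n where k: "k = Suc (2 * n)"
      by (auto elim!: oddE)
    have "a (Suc k) = (norm (proj M1 (proj M2 (u n))))\<^sup>2"
      using even[of "Suc n"] by (simp add: k u_Suc)
    then show ?thesis
      by (auto simp: k simp flip: odd intro!: power_mono norm_proj_le[OF M1])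
  qed
  then have "decseq a"
    by (rule decseq_SucI)
  moreover have "0 \<le> a k" for k
    by (cases "even k") (auto elim!: evenE oddE simp flip: even odd)
  ultimately obtain L where L: "a \<longlonglongrightarrow> L" "\<And>k. L \<le> a k"
    using decseq_convergent[of a 0] by blast
  have "Cauchy u"
  proof (rule Cauchy_if_norm_diff_sq_le)
    show "(norm (u m - u n))\<^sup>2 \<le> (a (2 * m) - L) + (a (2 * n) - L)" for m n
    proof -
      have "(norm (u m - u n))\<^sup>2 = a (2 * m) - 2 * a (m + n) + a (2 * n)"
        by (simp add: norm_sq ip_diff_left ip_diff_right ip_u add.commute[of n m] flip: mult_2)
      then show ?thesis
        using L(2)[of "m + n"] by simp
    qed
    have "(\<lambda>n. a (2 * n)) \<longlonglongrightarrow> L"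
      using LIMSEQ_subseq_LIMSEQ[OF L(1), of "\<lambda>n. 2 * n"] by (simp add: strict_mono_def o_def)
    then show "(\<lambda>n. a (2 * n) - L) \<longlonglongrightarrow> 0"
      by (rule LIM_zero)
  qed
  then obtain v where v: "u \<longlonglongrightarrow> v"
    using Cauchy_convergent convergent_def by blast
  have v1: "v \<in> M1"
    using closed_sequentially[OF M1(2) u_mem v] .
  have "(\<lambda>n. u (Suc n)) \<longlonglongrightarrow> proj M1 (proj M2 v)"
    unfolding u_Suc by (intro tendsto_proj M1 M2 v)
  then have fixed: "proj M1 (proj M2 v) = v"
    using LIMSEQ_unique LIMSEQ_Suc[OF v] by blast
  \<comment> \<open>Neither projection increases the norm and together they fix \<open>v\<close>, so
    \<open>proj M2\<close> loses no norm on \<open>v\<close>.\<close>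
  have "norm (proj M2 v) = norm v"
    using norm_proj_le[OF M1, of "proj M2 v"] norm_proj_le[OF M2, of v] fixed by simp
  then have v2: "proj M2 v = v"
    by (rule proj_eq_self_if_norm[OF M2])
  have "(\<lambda>n. T (Suc n)) \<longlonglongrightarrow> v"
    using tendsto_proj[OF M2 v] by (simp add: T_Suc v2)
  then have T: "T \<longlonglongrightarrow> v"
    by (rule LIMSEQ_imp_Suc)
  have "proj (M1 \<inter> M2) x = v"
  proof (rule proj_eqI)
    show "subspace (M1 \<inter> M2)"
      using assms by (simp add: subspace_inter)
    show "v \<in> M1 \<inter> M2"
      using v1 v2 proj_mem[OF M2, of v] by simp
    show "ip (x - v) z = 0" if "z \<in> M1 \<inter> M2" for z
    proof -
      \<comment> \<open>Both projections preserve inner products with elements of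
        \<open>M1 \<inter> M2\<close>; the identity passes to the limit.\<close>
      have "ip (T n) z = ip x z" for n
        using that by (induction n) (simp_all add: T_def ip_proj_left[OF M1] ip_proj_left[OF M2])
      with tendsto_ip[OF T tendsto_const, of z] have "ip v z = ip x z"
        by (simp add: LIMSEQ_const_iff)
      then show ?thesis
        by (simp add: ip_diff_left)
    qed
  qed
  with T show ?thesis
    by (simp flip: T_def)
qed

end

section \<open>The real and complex instances\<close>

lemma real_hilbert_inner: "real_hilbert (inner :: 'a::{real_inner, complete_space} \<Rightarrow> _)"
  by unfold_locales (simp_all add: inner_add_left power2_norm_eq_inner, rule inner_commute)

lemma real_hilbert_Re_cinner:
  "real_hilbert (\<lambda>x y :: 'a::complex_hilbert_space. Re (cinner x y))"
proof
  fix x y :: 'a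
  show "Re (cinner x y) = Re (cinner y x)"
    by (subst cinner_commute) simp
  show "(norm x)\<^sup>2 = Re (cinner x x)"
    by (simp add: norm_eq_sqrt_cinner cinner_ge_zero)
qed (simp_all add: cinner_add_left cinner_scaleC_left scaleR_scaleC)

lemma subspace_if_csubspace: "csubspace M \<Longrightarrow> subspace M"
  unfolding subspace_def complex_vector.subspace_def by (simp add: scaleR_scaleC)

text \<open>The imaginary part is read off from the real part at \<open>\<i> z\<close>.\<close>

lemma cinner_eq_0_iff_Re:
  assumes "csubspace M"
  shows "(\<forall>z\<in>M. cinner x z = 0) \<longleftrightarrow> (\<forall>z\<in>M. Re (cinner x z) = 0)"
proof (intro iffI ballI)
  fix z
  assume *: "\<forall>z\<in>M. Re (cinner x z) = 0" and z: "z \<in> M"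
  have "\<i> *\<^sub>C z \<in> M"
    using assms z by (rule complex_vector.subspace_scale)
  moreover have "cinner x (\<i> *\<^sub>C z) = cnj (\<i> * cinner z x)"
    by (subst cinner_commute) (simp only: cinner_scaleC_left)
  then have "cinner x (\<i> *\<^sub>C z) = - \<i> * cinner x z"
    by (subst cinner_commute[of x z]) simp
  ultimately have "Im (cinner x z) = 0"
    using * by fastforce
  with * z show "cinner x z = 0"
    by (simp add: complex_eq_iff)
qed simp

theorem theorem4p1:
  shows
    "(\<forall>(M1 :: 'a::{real_inner, complete_space} set) M2.
        subspace M1 \<and> closed M1 \<and> subspace M2 \<and> closed M2 \<longrightarrow>
        (\<forall>x. (\<lambda>n. norm (((orth_proj M2 \<circ> orth_proj M1) ^^ n) x - orth_proj (M1 \<inter> M2) x))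
               \<longlonglongrightarrow> 0))
     \<and>
     (\<forall>(M1 :: 'b::complex_hilbert_space set) M2.
        csubspace M1 \<and> closed M1 \<and> csubspace M2 \<and> closed M2 \<longrightarrow>
        (\<forall>x. (\<lambda>n. norm (((corth_proj M2 \<circ> corth_proj M1) ^^ n) x - corth_proj (M1 \<inter> M2) x))
               \<longlonglongrightarrow> 0))"
proof (intro conjI allI impI; elim conjE)
  fix M1 M2 :: "'a set" and x
  assume M: "subspace M1" "closed M1" "subspace M2" "closed M2"
  interpret real_hilbert "inner :: 'a \<Rightarrow> _"
    by (rule real_hilbert_inner)
  have "orth_proj M = proj M" for M :: "'a set"
    by (simp add: fun_eq_iff orth_proj_def proj_def orthogonal_def)
  then show "(\<lambda>n. norm (((orth_proj M2 \<circ> orth_proj M1) ^^ n) x - orth_proj (M1 \<inter> M2) x)) \<longlonglongrightarrow> 0"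
    using alternating_projections[OF M, of x]
    by (intro tendsto_norm_zero LIM_zero) simp
next
  fix M1 M2 :: "'b set" and x
  assume M: "csubspace M1" "closed M1" "csubspace M2" "closed M2"
  interpret real_hilbert "\<lambda>x y :: 'b. Re (cinner x y)"
    by (rule real_hilbert_Re_cinner)
  \<comment> \<open>Needs closure under multiplication by \<open>\<i>\<close>: orthogonality for the
    real part alone must force complex orthogonality.\<close>
  have "corth_proj M = proj M" if "csubspace M" for M :: "'b set"
    by (simp add: fun_eq_iff corth_proj_def proj_def cinner_eq_0_iff_Re[OF that])
  moreover have "csubspace (M1 \<inter> M2)"
    using M by (simp add: complex_vector.subspace_inter)
  ultimately show
    "(\<lambda>n. norm (((corth_proj M2 \<circ> corth_proj M1) ^^ n) x - corth_proj (M1 \<inter> M2) x)) \<longlonglongrightarrow> 0"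
    using M alternating_projections[of M1 M2 x]
    by (intro tendsto_norm_zero LIM_zero) (simp add: subspace_if_csubspace)
qed

end
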